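(* Let $K=G\times L$ be a finite abelian group (written additively), where either $L=\{0\}$ or $L$ is an elementary abelian $2$-group, and write $e=\exp(G)$. Let $U$ be a subgroup of $G$ such that every element of $U$ has a square root in $G$. Suppose that $f: G\times G\to\mathbb{Z}_e$ is a bilinear, symmetric, nondegenerate form, and that no element of $G\setminus U$ is orthogonal (with respect to $f$) to all elements of $U$. Let $R\subset G$ be a complete system of coset representatives of $U$ in $G$ with $0\in R$. For every $x\in K$ let $x_1\in U$, $x_2\in R$, $x_3\in L$ be the unique elements with $x=x_1+x_2+x_3$. Let $\beta$ be any integer coprime to $|G|$. Define the matrix $H=(H_{y,x})_{y,x\in K}$ by $$H_{y,x}=\zeta_e^{\,f((x-y)_1/2,\,(x-y)_1)+\beta f((x-y)_1,(x-y)_2)}\;\zeta_4^{\,s_L(x_3\oplus y_3)},$$ where $(x-y)_1/2$ denotes any square root of $(x-y)_1$ in $G$. Then $H$ is a $\mathrm{BH}(K,e_1)$ matrix, where $e_1=\exp(U)$ if $L=\{0\}$, $e_1=\mathrm{lcm}(2,\exp(U))$ if $L$ is of square order, and $e_1=\mathrm{lcm}(4,\exp(U))$ otherwise.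
   Context: For a positive integer $t$, $\zeta_t=\exp(2\pi i/t)$, and $\mathbb{Z}_t=\{0,\dots,t-1\}$ with addition mod $t$; since $f$ takes values in $\mathbb{Z}_e$, $\zeta_e^{f(\cdot,\cdot)}$ is well defined. $\exp(G)$ is the least common multiple of the orders of the elements of $G$. A map $f:G\times G\to\mathbb{Z}_e$ is bilinear if $f(g+h,k)=f(g,k)+f(h,k)$ and $f(g,h+k)=f(g,h)+f(g,k)$ for all $g,h,k$; symmetric if $f(g,h)=f(h,g)$; $g,h$ are orthogonal if $f(g,h)=0$; $f$ is nondegenerate if no nonzero $g\in G$ satisfies $f(g,h)=0$ for all $h\in G$. An element $h$ is a square root of $g$ if $g=2h$. For a finite abelian group $K$, a $\mathrm{BH}(K,h)$ matrix is a $|K|\times|K|$ matrix $H=(H_{g,k})_{g,k\in K}$ whose entries are complex $h$th roots of unity, which is $K$-invariant ($H_{g+l,k+l}=H_{g,k}$ for all $g,k,l\in K$), and which satisfies $HH^*=|K|I$ ($H^*$ the conjugate transpose). Definition of $s_L$: write $|L|=2^{2a+b}$ with $b\in\{0,1\}$, $c=2a+b$, and identify $L$ with $\{0,1\}^c$ under componentwise addition mod 2 (if $L=\{0\}$, $a=b=c=0$). For $g=(g_1,\dots,g_c)\in L$ define the integer $s_L(g)=2\sum_{i=1}^a g_ig_{a+i}$ if $b=0$ and $s_L(g)=2\sum_{i=1}^a g_ig_{a+i}+g_c$ if $b=1$ (sums taken in $\mathbb{Z}$). For $x,y\in L$, $x\oplus y$ is the componentwise sum mod 2. *)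

theory Defs
  imports "HOL-Analysis.Analysis" "HOL-Algebra.Algebra"
begin

text \<open>
  Abelian groups are the commutative groups of HOL-Algebra, so the additively written
  operations \<open>g + h\<close>, \<open>- g\<close>, \<open>2 h\<close>, \<open>0\<close> of the mathematics appear as
  \<open>g \<otimes> h\<close>, \<open>inv g\<close>, \<open>h \<otimes> h\<close>, \<open>\<one>\<close>. The ring \<open>\<int>\<^sub>t\<close> enters only through its additive group
  \<^const>\<open>integer_mod_group\<close>, whose elements are the integers \<open>0, \<dots>, t - 1\<close>.
\<close>

definition zeta :: "nat \<Rightarrow> complex" where
  "zeta t = exp (2 * of_real pi * \<i> / of_nat t)"

definition group_exponent :: "('a, 'm) monoid_scheme \<Rightarrow> nat" where
  "group_exponent G = Lcm (group.ord G ` carrier G)"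

definition subgroup_exponent :: "('a, 'm) monoid_scheme \<Rightarrow> 'a set \<Rightarrow> nat" where
  "subgroup_exponent G U = group_exponent (G\<lparr>carrier := U\<rparr>)"

definition is_square_root :: "('a, 'm) monoid_scheme \<Rightarrow> 'a \<Rightarrow> 'a \<Rightarrow> bool" where
  "is_square_root G h g \<longleftrightarrow> h \<in> carrier G \<and> g = h \<otimes>\<^bsub>G\<^esub> h"

definition elementary_abelian_2_group :: "('a, 'm) monoid_scheme \<Rightarrow> bool" where
  "elementary_abelian_2_group L \<longleftrightarrow>
     comm_group L \<and> (\<forall>x \<in> carrier L. x \<otimes>\<^bsub>L\<^esub> x = \<one>\<^bsub>L\<^esub>)"

definition bilinear_form :: "('a, 'm) monoid_scheme \<Rightarrow> nat \<Rightarrow> ('a \<Rightarrow> 'a \<Rightarrow> int) \<Rightarrow> bool" where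
  "bilinear_form G e f \<longleftrightarrow>
     (\<forall>k \<in> carrier G. (\<lambda>g. f g k) \<in> hom G (integer_mod_group e)) \<and>
     (\<forall>g \<in> carrier G. (\<lambda>k. f g k) \<in> hom G (integer_mod_group e))"

definition symmetric_form :: "('a, 'm) monoid_scheme \<Rightarrow> ('a \<Rightarrow> 'a \<Rightarrow> int) \<Rightarrow> bool" where
  "symmetric_form G f \<longleftrightarrow> (\<forall>g \<in> carrier G. \<forall>h \<in> carrier G. f g h = f h g)"

definition orthogonal_wrt :: "('a \<Rightarrow> 'a \<Rightarrow> int) \<Rightarrow> 'a \<Rightarrow> 'a \<Rightarrow> bool" where
  "orthogonal_wrt f g h \<longleftrightarrow> f g h = 0"

definition nondegenerate_form :: "('a, 'm) monoid_scheme \<Rightarrow> ('a \<Rightarrow> 'a \<Rightarrow> int) \<Rightarrow> bool" where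
  "nondegenerate_form G f \<longleftrightarrow>
     \<not> (\<exists>g \<in> carrier G. g \<noteq> \<one>\<^bsub>G\<^esub> \<and> (\<forall>h \<in> carrier G. f g h = 0))"

definition complete_coset_reps :: "('a, 'm) monoid_scheme \<Rightarrow> 'a set \<Rightarrow> 'a set \<Rightarrow> bool" where
  "complete_coset_reps G U R \<longleftrightarrow>
     R \<subseteq> carrier G \<and> (\<forall>C \<in> rcosets\<^bsub>G\<^esub> U. \<exists>!r. r \<in> R \<and> r \<in> C)"

text \<open>
  The components \<open>x\<^sub>1 \<in> U\<close>, \<open>x\<^sub>2 \<in> R\<close>, \<open>x\<^sub>3 \<in> L\<close> of an element \<open>x = x\<^sub>1 + x\<^sub>2 + x\<^sub>3\<close> of
  \<open>G \<times> L\<close>, where \<open>G\<close> and \<open>L\<close> are embedded in the product as \<open>g \<mapsto> (g, 0)\<close> and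
  \<open>l \<mapsto> (0, l)\<close>.
\<close>

definition components ::
  "('a, 'm) monoid_scheme \<Rightarrow> ('b, 'n) monoid_scheme \<Rightarrow> 'a set \<Rightarrow> 'a set \<Rightarrow>
    'a \<times> 'b \<Rightarrow> 'a \<times> 'a \<times> 'b" where
  "components G L U R x =
     (THE (x1, x2, x3). x1 \<in> U \<and> x2 \<in> R \<and> x3 \<in> carrier L \<and> x = (x1 \<otimes>\<^bsub>G\<^esub> x2, x3))"

definition comp1 where "comp1 G L U R x = fst (components G L U R x)"
definition comp2 where "comp2 G L U R x = fst (snd (components G L U R x))"
definition comp3 where "comp3 G L U R x = snd (snd (components G L U R x))"

lemma components_eqI:
  fixes G (structure)
  assumes G: "group G" and U: "subgroup U G" and R: "complete_coset_reps G U R"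
    and x: "x1 \<in> U" "x2 \<in> R" "x3 \<in> carrier L"
  shows "components G L U R (x1 \<otimes> x2, x3) = (x1, x2, x3)"
proof -
  interpret group G by (rule G)
  interpret U: subgroup U G by (rule U)
  have R_sub: "R \<subseteq> carrier G" using R by (simp add: complete_coset_reps_def)
  have uniq: "y1 = x1 \<and> y2 = x2"
    if y: "y1 \<in> U" "y2 \<in> R" and eq: "x1 \<otimes>\<^bsub>G\<^esub> x2 = y1 \<otimes>\<^bsub>G\<^esub> y2" for y1 y2
  proof -
    have c: "x1 \<in> carrier G" "x2 \<in> carrier G" "y1 \<in> carrier G" "y2 \<in> carrier G"
      using x y R_sub by auto
    have "y2 = inv y1 \<otimes> (x1 \<otimes> x2)"
      using eq c by (simp add: inv_solve_left)
    hence "y2 = (inv y1 \<otimes> x1) \<otimes> x2" using c by (simp add: m_assoc)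
    hence "y2 \<in> U #> x2" using x y by (auto simp: r_coset_def)
    moreover have "x2 \<in> U #> x2" using c U by (intro rcos_self) auto
    moreover have "U #> x2 \<in> rcosets U" using c by (auto simp: RCOSETS_def)
    ultimately have "y2 = x2" using R x y unfolding complete_coset_reps_def by blast
    thus ?thesis using eq c by simp
  qed
  show ?thesis unfolding components_def
  proof (rule the_equality)
    show "case (x1, x2, x3) of (z1, z2, z3) \<Rightarrow>
        z1 \<in> U \<and> z2 \<in> R \<and> z3 \<in> carrier L \<and> (x1 \<otimes> x2, x3) = (z1 \<otimes> z2, z3)"
      using x by simp
  next
    fix z
    assume z: "case z of (z1, z2, z3) \<Rightarrow>
        z1 \<in> U \<and> z2 \<in> R \<and> z3 \<in> carrier L \<and> (x1 \<otimes> x2, x3) = (z1 \<otimes> z2, z3)"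
    obtain z1 z2 z3 where zeq: "z = (z1, z2, z3)" by (cases z)
    show "z = (x1, x2, x3)" using z uniq[of z1 z2] unfolding zeq by simp
  qed
qed

lemma components_ex:
  fixes G (structure)
  assumes G: "group G" and U: "subgroup U G" and R: "complete_coset_reps G U R"
    and x: "x \<in> carrier (G \<times>\<times> L)"
  obtains x1 x2 x3 where "x1 \<in> U" "x2 \<in> R" "x3 \<in> carrier L" "x = (x1 \<otimes>\<^bsub>G\<^esub> x2, x3)"
proof -
  interpret group G by (rule G)
  interpret U: subgroup U G by (rule U)
  obtain g l where gl: "x = (g, l)" "g \<in> carrier G" "l \<in> carrier L"
    using x by (auto simp: DirProd_def)
  have "U #> g \<in> rcosets U" using gl by (auto simp: RCOSETS_def)
  then obtain r where r: "r \<in> R" "r \<in> U #> g"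
    using R unfolding complete_coset_reps_def by blast
  then obtain u where u: "u \<in> U" "r = u \<otimes> g" by (auto simp: r_coset_def)
  have "g = inv u \<otimes> r" using u gl by (simp add: inv_solve_left)
  thus ?thesis using that[of "inv u" r l] u r gl by auto
qed

text \<open>
  An identification of an elementary abelian 2-group \<open>L\<close> with \<open>{0,1}\<^sup>c\<close> under componentwise
  addition mod 2, coordinates being indexed by \<open>1, \<dots>, c\<close>.
\<close>

definition binary_identification :: "('b, 'n) monoid_scheme \<Rightarrow> nat \<Rightarrow> ('b \<Rightarrow> nat \<Rightarrow> int) \<Rightarrow> bool" where
  "binary_identification L c \<phi> \<longleftrightarrow>
     \<phi> \<in> iso L (product_group {1..c} (\<lambda>_. integer_mod_group 2))"

definition s_form :: "nat \<Rightarrow> nat \<Rightarrow> ('b \<Rightarrow> nat \<Rightarrow> int) \<Rightarrow> 'b \<Rightarrow> int" where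
  "s_form a b \<phi> g =
     2 * (\<Sum>i = 1..a. \<phi> g i * \<phi> g (a + i)) + (if b = 0 then 0 else \<phi> g (2 * a + b))"

text \<open>A matrix with rows and columns indexed by \<open>K\<close> is a function on \<open>K \<times> K\<close>;
  the last clause is \<open>H H\<^sup>* = |K| I\<close>.\<close>

definition BH_matrix :: "('k, 'm) monoid_scheme \<Rightarrow> nat \<Rightarrow> ('k \<Rightarrow> 'k \<Rightarrow> complex) \<Rightarrow> bool" where
  "BH_matrix K h H \<longleftrightarrow>
     h > 0 \<and>
     (\<forall>g \<in> carrier K. \<forall>k \<in> carrier K. H g k ^ h = 1) \<and>
     (\<forall>g \<in> carrier K. \<forall>k \<in> carrier K. \<forall>l \<in> carrier K.
        H (g \<otimes>\<^bsub>K\<^esub> l) (k \<otimes>\<^bsub>K\<^esub> l) = H g k) \<and>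
     (\<forall>g \<in> carrier K. \<forall>k \<in> carrier K.
        (\<Sum>j \<in> carrier K. H g j * cnj (H k j)) = (if g = k then of_nat (order K) else 0))"

end

theory Submission
  imports Defs "HOL-Number_Theory.Cong"
begin

text \<open>
  With \<open>P (g, l) = F g * S l\<close>, where \<open>F x = Q (x\<^sub>1) * B x\<^sub>1 x\<^sub>2 powi \<beta>\<close>,
  \<open>B x y = zeta e powi f x y\<close>, \<open>Q u = B (u/2) u\<close> and \<open>S l = zeta 4 powi s\<^sub>L l\<close>, the matrix is
  \<open>H y x = P (x - y)\<close> (in \<open>L\<close> differences are sums), so the rows are orthogonal once every
  autocorrelation of \<open>F\<close> and of \<open>S\<close> at a nonzero shift \<open>w\<close> vanishes.

  \<open>S\<close> is quadratic with nondegenerate polarisation \<open>C\<close>, that is \<open>S (x + w) = S x * S w * C x w\<close>, so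
  its autocorrelation is \<open>S w\<close> times a sum of a nontrivial character.
  \<open>Q\<close> is quadratic on \<open>U\<close> with polarisation \<open>B\<close>. Translating the autocorrelation sum of \<open>F\<close> by
  \<open>u \<in> U\<close> multiplies the summand at \<open>x\<close> by \<open>B u D\<close>, where
  \<open>D = ((x + w)\<^sub>1 - x\<^sub>1) + \<beta> ((x + w)\<^sub>2 - x\<^sub>2)\<close>; averaging over \<open>U\<close> kills every summand with \<open>D\<close> not
  orthogonal to \<open>U\<close>. If some \<open>D\<close> is orthogonal to \<open>U\<close>, then \<open>D \<in> U\<close>, hence \<open>w \<in> U\<close> as \<open>\<beta>\<close> is coprime
  to the order of \<open>G\<close>, so \<open>D = w\<close>, and the autocorrelation is \<open>Q w\<close> times the sum of the
  nontrivial character \<open>x \<mapsto> B w x powi \<beta>\<close>.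
\<close>

section \<open>Character sums and group-developed matrices\<close>

lemma (in group) sum_translate_right:
  assumes "a \<in> carrier G"
  shows "(\<Sum>x\<in>carrier G. F (x \<otimes> a)) = sum F (carrier G)"
  by (rule sum.reindex_bij_witness[where i = "\<lambda>x. x \<otimes> inv a" and j = "\<lambda>x. x \<otimes> a"])
    (use assms in \<open>auto simp: m_assoc\<close>)

text \<open>Translation by \<open>a\<close> leaves the sum unchanged but also multiplies it by
  \<open>\<psi> a\<close>, which is not 1.\<close>

lemma (in group) sum_character_eq_0:
  fixes \<psi> :: "'a \<Rightarrow> complex"
  assumes mult: "\<And>x y. \<lbrakk>x \<in> carrier G; y \<in> carrier G\<rbrakk> \<Longrightarrow> \<psi> (x \<otimes> y) = \<psi> x * \<psi> y"
    and a: "a \<in> carrier G" "\<psi> a \<noteq> 1"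
  shows "sum \<psi> (carrier G) = 0"
proof -
  have "sum \<psi> (carrier G) = (\<Sum>x\<in>carrier G. \<psi> (x \<otimes> a))"
    using sum_translate_right[OF a(1), of \<psi>] by simp
  also have "\<dots> = sum \<psi> (carrier G) * \<psi> a"
    by (simp add: mult a sum_distrib_right)
  finally show ?thesis using a(2) by simp
qed

lemma mult_cnj_eq_1: "z * cnj z = 1" if "norm z = 1"
  using that by (simp add: complex_norm_square[symmetric])

text \<open>Substituting \<open>j = x + k\<close> turns the inner product of rows \<open>g\<close>
  and \<open>k\<close> into the autocorrelation of \<open>P\<close> at the shift
  \<open>k - g\<close>. On the diagonal every summand is 1, because roots of unity have norm
  1.\<close>

lemma BH_matrix_group_developed:
  assumes K: "group K" "finite (carrier K)" and h: "h > 0"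
    and H: "\<And>y x. \<lbrakk>y \<in> carrier K; x \<in> carrier K\<rbrakk> \<Longrightarrow> H y x = P (x \<otimes>\<^bsub>K\<^esub> inv\<^bsub>K\<^esub> y)"
    and root: "\<And>x. x \<in> carrier K \<Longrightarrow> P x ^ h = 1"
    and perfect: "\<And>w. \<lbrakk>w \<in> carrier K; w \<noteq> \<one>\<^bsub>K\<^esub>\<rbrakk> \<Longrightarrow>
      (\<Sum>x\<in>carrier K. P (x \<otimes>\<^bsub>K\<^esub> w) * cnj (P x)) = 0"
  shows "BH_matrix K h H"
proof -
  interpret group K by (rule K)
  have norm: "norm (P x) = 1" if "x \<in> carrier K" for x
    using root[OF that] h by (metis norm_one norm_power norm_ge_zero power_eq_1_iff zero_less_iff_neq_zero)
  have dev: "H (g \<otimes>\<^bsub>K\<^esub> l) (k \<otimes>\<^bsub>K\<^esub> l) = H g k"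
    if "g \<in> carrier K" "k \<in> carrier K" "l \<in> carrier K" for g k l
  proof -
    have "k \<otimes>\<^bsub>K\<^esub> l \<otimes>\<^bsub>K\<^esub> inv\<^bsub>K\<^esub> (g \<otimes>\<^bsub>K\<^esub> l) = k \<otimes>\<^bsub>K\<^esub> (l \<otimes>\<^bsub>K\<^esub> (inv\<^bsub>K\<^esub> l \<otimes>\<^bsub>K\<^esub> inv\<^bsub>K\<^esub> g))"
      using that by (simp add: inv_mult_group m_assoc)
    also have "\<dots> = k \<otimes>\<^bsub>K\<^esub> inv\<^bsub>K\<^esub> g" using that by (simp add: m_assoc[symmetric])
    finally show ?thesis using that by (simp add: H)
  qed
  have orth: "(\<Sum>j\<in>carrier K. H g j * cnj (H k j)) = (if g = k then of_nat (order K) else 0)"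
    if gk: "g \<in> carrier K" "k \<in> carrier K" for g k
  proof -
    have "(\<Sum>j\<in>carrier K. H g j * cnj (H k j)) =
        (\<Sum>x\<in>carrier K. H g (x \<otimes>\<^bsub>K\<^esub> k) * cnj (H k (x \<otimes>\<^bsub>K\<^esub> k)))"
      by (rule sum_translate_right[symmetric]) (rule gk)
    also have "\<dots> = (\<Sum>x\<in>carrier K. P (x \<otimes>\<^bsub>K\<^esub> (k \<otimes>\<^bsub>K\<^esub> inv\<^bsub>K\<^esub> g)) * cnj (P x))"
      using gk by (intro sum.cong) (auto simp: H m_assoc)
    also have "\<dots> = (if g = k then of_nat (order K) else 0)"
    proof (cases "g = k")
      case True
      then show ?thesis using gk by (simp add: mult_cnj_eq_1 norm order_def)
    next
      case False
      then have "k \<otimes>\<^bsub>K\<^esub> inv\<^bsub>K\<^esub> g \<noteq> \<one>\<^bsub>K\<^esub>"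
        using gk by (metis inv_closed inv_equality inv_inv)
      then show ?thesis using gk False by (simp add: perfect)
    qed
    finally show ?thesis .
  qed
  show ?thesis unfolding BH_matrix_def
    using h dev orth root by (auto simp: H)
qed

section \<open>Bicharacters and quadratic functions\<close>

text \<open>Common setting for two uses: \<open>zeta e powi f x y\<close> on \<open>G\<close>, and
  the polarisation of the fourth roots of unity attached to \<open>L\<close>.\<close>

locale bicharacter = comm_group G for G (structure) +
  fixes B :: "'a \<Rightarrow> 'a \<Rightarrow> complex"
  assumes mult_left:
      "\<lbrakk>x \<in> carrier G; y \<in> carrier G; z \<in> carrier G\<rbrakk> \<Longrightarrow> B (x \<otimes> y) z = B x z * B y z"
    and sym: "\<lbrakk>x \<in> carrier G; y \<in> carrier G\<rbrakk> \<Longrightarrow> B x y = B y x"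
    and norm_B [simp]: "\<lbrakk>x \<in> carrier G; y \<in> carrier G\<rbrakk> \<Longrightarrow> norm (B x y) = 1"
begin

lemma mult_right:
  "\<lbrakk>x \<in> carrier G; y \<in> carrier G; z \<in> carrier G\<rbrakk> \<Longrightarrow> B x (y \<otimes> z) = B x y * B x z"
  by (simp add: mult_left sym[of x])

lemma nonzero [simp]: "\<lbrakk>x \<in> carrier G; y \<in> carrier G\<rbrakk> \<Longrightarrow> B x y \<noteq> 0"
  by (metis norm_B norm_zero zero_neq_one)

lemma one_right [simp]:
  assumes "x \<in> carrier G"
  shows "B x \<one> = 1"
proof -
  have "B x \<one> * B x \<one> = B x \<one>" using assms by (simp flip: mult_right)
  then show ?thesis using assms by simp
qed

lemma inv_right: "\<lbrakk>x \<in> carrier G; y \<in> carrier G\<rbrakk> \<Longrightarrow> B x (inv y) = inverse (B x y)"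
  by (rule inverse_unique[symmetric]) (simp flip: mult_right)

lemma nat_pow_right: "\<lbrakk>x \<in> carrier G; y \<in> carrier G\<rbrakk> \<Longrightarrow> B x (y [^] (n::nat)) = B x y ^ n"
  by (induction n) (simp_all add: mult_right)

lemma int_pow_right: "\<lbrakk>x \<in> carrier G; y \<in> carrier G\<rbrakk> \<Longrightarrow> B x (y [^] (n::int)) = B x y powi n"
  unfolding int_pow_def2 power_int_def by (auto simp: inv_right nat_pow_right power_inverse simp del: pow_nat)

text \<open>Since \<open>S x\<close> has norm 1, each summand reduces to \<open>S w * B x w\<close>;
  the point \<open>x0\<close> makes the character in \<open>x\<close> nontrivial.\<close>

lemma perfect_quadratic:
  assumes S: "\<And>x y. \<lbrakk>x \<in> carrier G; y \<in> carrier G\<rbrakk> \<Longrightarrow> S (x \<otimes> y) = S x * S y * B x y"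
    and norm_S: "\<And>x. x \<in> carrier G \<Longrightarrow> norm (S x) = 1"
    and w: "w \<in> carrier G" "x0 \<in> carrier G" "B x0 w \<noteq> 1"
  shows "(\<Sum>x\<in>carrier G. S (x \<otimes> w) * cnj (S x)) = 0"
proof -
  have "S (x \<otimes> w) * cnj (S x) = S w * B x w" if "x \<in> carrier G" for x
  proof -
    have "S (x \<otimes> w) * cnj (S x) = (S x * cnj (S x)) * (S w * B x w)"
      using that w by (simp add: S)
    then show ?thesis using that by (simp add: mult_cnj_eq_1 norm_S)
  qed
  moreover have "(\<Sum>x\<in>carrier G. B x w) = 0"
    using w by (intro sum_character_eq_0[of _ x0]) (auto simp: mult_left)
  ultimately show ?thesis by (simp flip: sum_distrib_left)
qed

text \<open>The value of \<open>Q\<close> may be computed from any square root, so the root of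
  \<open>u + v\<close> can be chosen as the sum \<open>h + k\<close> of a root of \<open>u\<close>
  and a root of \<open>v\<close>.\<close>

lemma square_root_form_mult:
  assumes U: "subgroup U G" and roots: "\<And>u. u \<in> U \<Longrightarrow> \<exists>h. is_square_root G h u"
    and Q: "\<And>h u. \<lbrakk>u \<in> U; is_square_root G h u\<rbrakk> \<Longrightarrow> Q u = B h u"
    and uv: "u \<in> U" "v \<in> U"
  shows "Q (u \<otimes> v) = Q u * Q v * B u v"
proof -
  obtain h k where h: "h \<in> carrier G" "u = h \<otimes> h" and k: "k \<in> carrier G" "v = k \<otimes> k"
    using roots uv unfolding is_square_root_def by blast
  have "is_square_root G (h \<otimes> k) (u \<otimes> v)"
    using h k by (simp add: is_square_root_def m_ac)
  then have "Q (u \<otimes> v) = B (h \<otimes> k) (u \<otimes> v)"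
    using Q uv U by (meson subgroup.m_closed)
  also have "\<dots> = B h u * B k v * (B h v * B k u)"
    using h k by (simp add: mult_left mult_right)
  \<comment> \<open>As \<open>u = 2h\<close> and \<open>v = 2k\<close>, both sides are the fourth
    power of \<open>B h k\<close>.\<close>
  also have "B h v * B k u = B u v"
    using h k by (simp add: mult_left mult_right sym[of k h])
  finally show ?thesis using h k Q uv by (simp add: is_square_root_def)
qed

lemma pow_order:
  assumes "x \<in> carrier G" "y \<in> carrier G"
  shows "B x y ^ order G = 1"
  using assms nat_pow_right[of x y "order G"] by (simp add: pow_order_eq_1)

text \<open>\<open>B x y\<close> is killed by the exponent \<open>order G\<close>, and by Bezout
  \<beta> is invertible modulo that order.\<close>

lemma powi_eq_1D:
  assumes xy: "x \<in> carrier G" "y \<in> carrier G"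
    and "coprime \<beta> (int (order G))" "B x y powi \<beta> = 1"
  shows "B x y = 1"
proof -
  obtain s t where "s * \<beta> + t * int (order G) = 1"
    using assms(3) by (metis bezout_int coprime_iff_gcd_eq_1)
  then have "B x y = B x y powi (\<beta> * s + int (order G) * t)"
    by (simp add: mult.commute)
  also have "\<dots> = (B x y powi \<beta>) powi s * (B x y powi int (order G)) powi t"
    using xy by (simp add: power_int_add power_int_mult)
  also have "\<dots> = 1" using assms xy by (simp add: pow_order)
  finally show ?thesis .
qed

end

section \<open>Autocorrelation of a function that is quadratic along the cosets of a
  subgroup\<close>

lemma (in group) int_pow_mem_subgroupD:
  assumes "subgroup U G" "x \<in> carrier G" "coprime n (int (order G))" "x [^] n \<in> U"
  shows "x \<in> U"
proof -
  \<comment> \<open>The Bezout coefficient \<open>s\<close> undoes the power \<open>n\<close>: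
    \<open>x\<close> is the \<open>s\<close>-th power of \<open>x [^] n\<close>, hence in
    \<open>U\<close>.\<close>
  obtain s t where "s * n + t * int (order G) = 1"
    using assms(3) by (metis bezout_int coprime_iff_gcd_eq_1)
  then have "x = x [^] (n * s + int (order G) * t)"
    using assms by (simp add: mult.commute)
  also have "\<dots> = (x [^] n) [^] s \<otimes> (x [^] int (order G)) [^] t"
    using assms by (simp add: int_pow_mult int_pow_pow)
  also have "\<dots> = (x [^] n) [^] s"
    using assms by (simp add: int_pow_int pow_order_eq_1)
  finally show ?thesis using assms subgroup_int_pow_closed by metis
qed

text \<open>Here \<open>p\<close> and \<open>r\<close> stand for the two components of an element of
  \<open>G\<close>. All that is used of the representatives is that translation by \<open>u\<close>
  in \<open>U\<close> shifts \<open>p\<close> by \<open>u\<close> and fixes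
  \<open>r\<close>.\<close>

lemma (in bicharacter) perfect_coset_quadratic:
  fixes \<beta> :: int
  assumes fin: "finite (carrier G)" and U: "subgroup U G"
    and Q: "\<And>u v. \<lbrakk>u \<in> U; v \<in> U\<rbrakk> \<Longrightarrow> Q (u \<otimes> v) = Q u * Q v * B u v"
    and norm_Q: "\<And>u. u \<in> U \<Longrightarrow> norm (Q u) = 1"
    and orth: "\<And>g. \<lbrakk>g \<in> carrier G; \<And>u. u \<in> U \<Longrightarrow> B u g = 1\<rbrakk> \<Longrightarrow> g \<in> U"
    and nondeg: "\<And>g. \<lbrakk>g \<in> carrier G; \<And>x. x \<in> carrier G \<Longrightarrow> B g x = 1\<rbrakk> \<Longrightarrow> g = \<one>"
    and p: "\<And>x. x \<in> carrier G \<Longrightarrow> p x \<in> U"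
    and r: "\<And>x. x \<in> carrier G \<Longrightarrow> r x \<in> carrier G"
    and pr: "\<And>x. x \<in> carrier G \<Longrightarrow> p x \<otimes> r x = x"
    and p_U: "\<And>u x. \<lbrakk>u \<in> U; x \<in> carrier G\<rbrakk> \<Longrightarrow> p (u \<otimes> x) = u \<otimes> p x"
    and r_U: "\<And>u x. \<lbrakk>u \<in> U; x \<in> carrier G\<rbrakk> \<Longrightarrow> r (u \<otimes> x) = r x"
    and \<beta>: "coprime \<beta> (int (order G))"
    and F: "\<And>x. x \<in> carrier G \<Longrightarrow> F x = Q (p x) * B (p x) (r x) powi \<beta>"
    and w: "w \<in> carrier G" "w \<noteq> \<one>"
  shows "(\<Sum>x\<in>carrier G. F (x \<otimes> w) * cnj (F x)) = 0"
proof -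
  interpret U: subgroup U G by (rule U)
  interpret UG: group "G\<lparr>carrier := U\<rparr>" by (rule subgroup.subgroup_is_group[OF U is_group])
  have p' [simp]: "p x \<in> carrier G" if "x \<in> carrier G" for x using p[OF that] by simp
  note r [simp]
  have norm_F: "norm (F x) = 1" if "x \<in> carrier G" for x
    using that p by (simp add: F norm_mult norm_power_int norm_Q)
  \<comment> \<open>Only \<open>p\<close> moves, so the quadratic law of \<open>Q\<close>
    contributes \<open>B u (p x)\<close> and the mixed term contributes \<open>B u (r x)\<close> to
    the power \<beta>; both merge into one character value at \<open>u\<close>.\<close>
  have F_U: "F (u \<otimes> x) = F x * (Q u * B u (p x \<otimes> r x [^] \<beta>))" if "u \<in> U" "x \<in> carrier G" for u x
    using that p by (simp add: F p_U r_U Q mult_left mult_right int_pow_right power_int_mult_distrib)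
  \<comment> \<open>The difference between the second arguments of \<open>B u\<close> in
    \<open>F_U\<close> at \<open>x + w\<close> and at \<open>x\<close>.\<close>
  define D where "D x = (p (x \<otimes> w) \<otimes> inv (p x)) \<otimes> (r (x \<otimes> w) \<otimes> inv (r x)) [^] \<beta>" for x
  have D_closed [simp]: "D x \<in> carrier G" if "x \<in> carrier G" for x using that w by (simp add: D_def)
  let ?T = "\<lambda>x. F (x \<otimes> w) * cnj (F x)"
  show ?thesis
  proof (cases "\<forall>x\<in>carrier G. \<exists>u\<in>U. B u (D x) \<noteq> 1")
    case True
    \<comment> \<open>The two factors \<open>Q u\<close> cancel by conjugation, and conjugating a
      value of \<open>B u\<close> inverts its argument.\<close>
    have T_U: "?T (x \<otimes> u) = ?T x * B u (D x)" if "u \<in> U" "x \<in> carrier G" for u x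
    proof -
      have u: "u \<in> carrier G" using that by simp
      have "x \<otimes> u \<otimes> w = u \<otimes> (x \<otimes> w)" "x \<otimes> u = u \<otimes> x" using u that w by (simp_all add: m_ac)
      then have "?T (x \<otimes> u) = ?T x * ((Q u * cnj (Q u)) *
          (B u (p (x \<otimes> w) \<otimes> r (x \<otimes> w) [^] \<beta>) * cnj (B u (p x \<otimes> r x [^] \<beta>))))"
        using that w by (simp add: F_U)
      also have "cnj (B u (p x \<otimes> r x [^] \<beta>)) = B u (inv (p x \<otimes> r x [^] \<beta>))"
        using u that by (simp add: inv_right inverse_unique[OF mult_cnj_eq_1, symmetric])
      also have "B u (p (x \<otimes> w) \<otimes> r (x \<otimes> w) [^] \<beta>) * \<dots> = B u (D x)"
      proof -
        have "D x = p (x \<otimes> w) \<otimes> r (x \<otimes> w) [^] \<beta> \<otimes> inv (p x \<otimes> r x [^] \<beta>)"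
          using that w unfolding D_def by (simp add: int_pow_distrib int_pow_inv inv_mult m_ac)
        then show ?thesis using u that w by (simp add: mult_right)
      qed
      finally show ?thesis using that by (simp add: norm_Q mult_cnj_eq_1)
    qed
    \<comment> \<open>Averaging: every translate of the sum equals the sum itself. After swapping
      the sums, the inner one is a nontrivial character sum over \<open>U\<close>.\<close>
    have "of_nat (card U) * sum ?T (carrier G) = (\<Sum>u\<in>U. \<Sum>x\<in>carrier G. ?T (x \<otimes> u))"
      by (simp add: sum_translate_right[where F = ?T] cong: sum.cong)
    also have "\<dots> = (\<Sum>u\<in>U. \<Sum>x\<in>carrier G. ?T x * B u (D x))"
      by (intro sum.cong refl T_U)
    also have "\<dots> = (\<Sum>x\<in>carrier G. ?T x * (\<Sum>u\<in>U. B u (D x)))"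
      by (subst sum.swap) (simp only: sum_distrib_left)
    also have "\<dots> = 0"
    proof (intro sum.neutral ballI)
      fix x assume x: "x \<in> carrier G"
      obtain a where "a \<in> U" "B a (D x) \<noteq> 1" using True x by blast
      then have "(\<Sum>u\<in>U. B u (D x)) = 0"
        using UG.sum_character_eq_0[of "\<lambda>u. B u (D x)" a] x by (simp add: mult_left)
      then show "?T x * (\<Sum>u\<in>U. B u (D x)) = 0" by simp
    qed
    finally show ?thesis
      using finite_subset[OF U.subset fin] U.one_closed by (metis card_0_eq empty_iff mult_eq_0_iff of_nat_eq_0_iff)
  next
    case False
    then obtain x where x: "x \<in> carrier G" and Dx: "\<And>u. u \<in> U \<Longrightarrow> B u (D x) = 1" by blast
    \<comment> \<open>Removing the \<open>U\<close>-part of \<open>D x\<close> leaves \<beta> times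
      the difference of the representatives in \<open>U\<close>; coprimality then removes
      \<beta>.\<close>
    have "D x \<in> U" by (rule orth) (use x Dx in simp_all)
    moreover have p_part: "p (x \<otimes> w) \<otimes> inv (p x) \<in> U" using x w p by simp
    ultimately have "inv (p (x \<otimes> w) \<otimes> inv (p x)) \<otimes> D x \<in> U" by simp
    also have "inv (p (x \<otimes> w) \<otimes> inv (p x)) \<otimes> D x = (r (x \<otimes> w) \<otimes> inv (r x)) [^] \<beta>"
      using x w unfolding D_def by (subst m_assoc[symmetric]) auto
    finally have "(r (x \<otimes> w) \<otimes> inv (r x)) [^] \<beta> \<in> U" .
    then have "r (x \<otimes> w) \<otimes> inv (r x) \<in> U"
      by (rule int_pow_mem_subgroupD[OF U _ \<beta>, rotated]) (use x w in simp)
    moreover have w_eq: "w = (p (x \<otimes> w) \<otimes> inv (p x)) \<otimes> (r (x \<otimes> w) \<otimes> inv (r x))"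
    proof -
      have "(p (x \<otimes> w) \<otimes> inv (p x)) \<otimes> (r (x \<otimes> w) \<otimes> inv (r x)) =
          (p (x \<otimes> w) \<otimes> r (x \<otimes> w)) \<otimes> inv (p x \<otimes> r x)"
        using x w by (simp add: inv_mult m_ac)
      also have "\<dots> = w \<otimes> x \<otimes> inv x" using x w by (simp add: pr m_comm)
      also have "\<dots> = w" using x w by (simp add: m_assoc)
      finally show ?thesis by simp
    qed
    ultimately have wU: "w \<in> U" using p_part by (metis U.m_closed)
    \<comment> \<open>Once \<open>w\<close> lies in \<open>U\<close>, the representatives of
      \<open>x\<close> and \<open>x + w\<close> coincide, so \<open>D x\<close> collapses to
      \<open>w\<close> and \<open>w\<close> is orthogonal to all of \<open>U\<close>.\<close>
    have "x \<otimes> w = w \<otimes> x" using x w by (simp add: m_comm)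
    then have "r (x \<otimes> w) = r x" using r_U wU x by simp
    then have "D x = w" using x w w_eq by (simp add: D_def)
    then have Bw: "B w u = 1" if "u \<in> U" for u using Dx that wU sym by fastforce
    have T: "?T y = Q w * B w y powi \<beta>" if "y \<in> carrier G" for y
    proof -
      have "y \<otimes> w = w \<otimes> y" using that w by (simp add: m_comm)
      then have "?T y = (F y * cnj (F y)) * (Q w * (B w (p y) * B w (r y) powi \<beta>))"
        using that w wU by (simp add: F_U mult_right int_pow_right)
      also have "B w (p y) = 1" using Bw p that by simp
      also have "B w (r y) = B w y"
        using that w Bw p mult_right[of w "p y" "r y"] by (simp add: pr)
      finally show ?thesis using that by (simp add: norm_F mult_cnj_eq_1)
    qed
    \<comment> \<open>Nondegeneracy makes \<open>B w\<close> nontrivial, and a power coprime to the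
      order keeps it so.\<close>
    obtain y where "y \<in> carrier G" "B w y \<noteq> 1" using nondeg w by blast
    then have "(\<Sum>y\<in>carrier G. B w y powi \<beta>) = 0"
      using w powi_eq_1D[OF _ _ \<beta>]
      by (intro sum_character_eq_0[of _ y]) (auto simp: mult_right power_int_mult_distrib)
    then show ?thesis by (simp add: T flip: sum_distrib_left)
  qed
qed


section \<open>Powers of \<open>zeta t\<close>\<close>

lemma zeta_powi: "zeta t powi n = cis (2 * pi * of_int n / of_nat t)"
proof -
  have "zeta t = cis (2 * pi / of_nat t)"
    by (simp add: zeta_def cis_conv_exp mult_ac)
  then show ?thesis by (simp add: cis_power_int mult_ac)
qed

lemma norm_zeta_powi [simp]: "norm (zeta t powi n) = 1"
  by (simp add: zeta_powi)

lemma zeta_nonzero [simp]: "zeta t \<noteq> 0"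
  by (simp add: zeta_def)

lemma zeta_powi_eq_1_iff:
  assumes "t > 0"
  shows "zeta t powi n = 1 \<longleftrightarrow> int t dvd n"
proof -
  have "zeta t powi n = exp (\<i> * of_real (2 * pi * of_int n / of_nat t))"
    by (simp add: zeta_powi cis_conv_exp)
  also have "\<dots> = 1 \<longleftrightarrow> (\<exists>k::int. 2 * pi * of_int n / of_nat t = of_int (2 * k) * pi)"
    by (simp add: exp_eq_1)
  also have "\<dots> \<longleftrightarrow> (\<exists>k. real_of_int n = real_of_int (int t * k))"
    using assms by (simp add: field_simps)
  also have "\<dots> \<longleftrightarrow> int t dvd n"
    by (simp only: of_int_eq_iff dvd_def)
  finally show ?thesis .
qed

lemma zeta_powi_cong:
  assumes "t > 0" "[m = n] (mod int t)"
  shows "zeta t powi m = zeta t powi n"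
proof -
  have "zeta t powi m = zeta t powi n * zeta t powi (m - n)"
    by (simp flip: power_int_add)
  then show ?thesis using assms by (simp add: zeta_powi_eq_1_iff cong_iff_dvd_diff)
qed

text \<open>Exponents of \<open>zeta 4\<close> matter modulo 4, but the sums in
  \<open>s_form\<close> are doubled, so computing them from bits modulo 2 is enough.\<close>

lemma cong_double:
  assumes "[m = n] (mod (2::int))"
  shows "[2 * m = 2 * n] (mod 4)"
  using assms unfolding cong_def by presburger

lemma zeta_powi_power_eq_1:
  assumes "t > 0" "int t dvd n * int m"
  shows "(zeta t powi n) ^ m = 1"
proof -
  have "(zeta t powi n) ^ m = zeta t powi (n * int m)" by (simp add: power_int_mult)
  then show ?thesis using assms by (simp add: zeta_powi_eq_1_iff)
qed

section \<open>Exponents of groups, and forms as bicharacters\<close>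

lemma (in group) pow_group_exponent:
  assumes "x \<in> carrier G"
  shows "x [^] group_exponent G = \<one>"
  using assms by (simp add: pow_eq_id group_exponent_def)

lemma (in group) group_exponent_pos:
  assumes "finite (carrier G)"
  shows "group_exponent G > 0"
proof -
  have "ord x \<noteq> 0" if "x \<in> carrier G" for x using ord_ge_1[OF assms that] by simp
  then have "0 \<notin> ord ` carrier G" by force
  then show ?thesis using assms by (simp add: group_exponent_def Lcm_0_iff neq0_conv[symmetric] del: neq0_conv)
qed

lemma (in group) pow_subgroup_exponent:
  assumes "subgroup U G" "u \<in> U"
  shows "u [^] subgroup_exponent G U = \<one>"
  using group.pow_group_exponent[OF subgroup.subgroup_is_group[OF assms(1) is_group], of u] assms
  by (simp add: subgroup_exponent_def flip: nat_pow_consistent)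

lemma (in group) subgroup_exponent_pos:
  assumes "subgroup U G" "finite (carrier G)"
  shows "subgroup_exponent G U > 0"
  unfolding subgroup_exponent_def
  using assms subgroup.subset
  by (intro group.group_exponent_pos subgroup.subgroup_is_group[OF _ is_group]) (auto intro: finite_subset)

text \<open>Addition in \<open>integer_mod_group e\<close> reduces modulo \<open>e\<close>, which
  \<open>zeta e\<close> does not notice.\<close>

lemma bicharacter_of_form:
  assumes G: "comm_group G" and e: "e > 0"
    and f: "bilinear_form G e f" "symmetric_form G f"
  shows "bicharacter G (\<lambda>x y. zeta e powi f x y)"
proof -
  interpret comm_group G by (rule G)
  show ?thesis
  proof
    fix x y z assume xyz: "x \<in> carrier G" "y \<in> carrier G" "z \<in> carrier G"
    then have "f (x \<otimes>\<^bsub>G\<^esub> y) z = (f x z + f y z) mod int e"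
      using f(1) by (auto simp: bilinear_form_def hom_def)
    then have "zeta e powi f (x \<otimes>\<^bsub>G\<^esub> y) z = zeta e powi (f x z + f y z)"
      using e by (intro zeta_powi_cong) (auto simp: cong_def)
    then show "zeta e powi f (x \<otimes>\<^bsub>G\<^esub> y) z = zeta e powi f x z * zeta e powi f y z"
      by (simp add: power_int_add)
  next
    fix x y assume "x \<in> carrier G" "y \<in> carrier G"
    then show "zeta e powi f x y = zeta e powi f y x"
      using f(2) by (simp add: symmetric_form_def)
  qed simp
qed

text \<open>For positive \<open>e\<close> the values of \<open>f\<close> are residues from 0 to
  \<open>e - 1\<close>, of which only 0 is divisible by \<open>e\<close>.\<close>

lemma zeta_form_eq_1_iff:
  assumes "bilinear_form G e f" "e > 0" "x \<in> carrier G" "y \<in> carrier G"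
  shows "zeta e powi f x y = 1 \<longleftrightarrow> f x y = 0"
proof -
  have "f x y \<in> {0..<int e}"
    using assms by (fastforce simp: bilinear_form_def hom_def carrier_integer_mod_group)
  then show ?thesis using assms(2) by (auto simp: zeta_powi_eq_1_iff dest: zdvd_imp_le)
qed


section \<open>The fourth roots of unity on the elementary abelian 2-group\<close>

text \<open>The polarisation of \<open>s_form\<close>, meaningful modulo 2: \<open>a\<close>
  hyperbolic planes pairing coordinates \<open>i\<close> and \<open>a + i\<close>, plus for odd rank
  a last coordinate paired with itself.\<close>

definition s_polar :: "nat \<Rightarrow> nat \<Rightarrow> ('b \<Rightarrow> nat \<Rightarrow> int) \<Rightarrow> 'b \<Rightarrow> 'b \<Rightarrow> int" where
  "s_polar a b \<phi> x y =
     (\<Sum>i = 1..a. \<phi> x i * \<phi> y (a + i) + \<phi> y i * \<phi> x (a + i))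
     + (if b = 0 then 0 else \<phi> x (2 * a + b) * \<phi> y (2 * a + b))"

context
  fixes L :: "('l, 'n) monoid_scheme" and a b :: nat and \<phi> :: "'l \<Rightarrow> nat \<Rightarrow> int"
  assumes \<phi>: "binary_identification L (2 * a + b) \<phi>" and b: "b \<in> {0, 1}"
begin

lemma binary_hom: "\<phi> \<in> hom L (product_group {1..2 * a + b} (\<lambda>_. integer_mod_group 2))"
  and binary_bij: "bij_betw \<phi> (carrier L) (\<Pi>\<^sub>E i\<in>{1..2 * a + b}. carrier (integer_mod_group 2))"
  using \<phi> by (simp_all add: binary_identification_def iso_def)

lemma binary_closed:
  "x \<in> carrier L \<Longrightarrow> \<phi> x \<in> (\<Pi>\<^sub>E i\<in>{1..2 * a + b}. carrier (integer_mod_group 2))"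
  using bij_betwE[OF binary_bij] by blast

lemma binary_mult:
  assumes "x \<in> carrier L" "y \<in> carrier L" "i \<in> {1..2 * a + b}"
  shows "\<phi> (x \<otimes>\<^bsub>L\<^esub> y) i = (\<phi> x i + \<phi> y i) mod 2"
  using hom_mult[OF binary_hom assms(1,2)] assms(3) by simp

lemma binary_cong:
  assumes "x \<in> carrier L" "y \<in> carrier L" "i \<in> {1..2 * a + b}"
  shows "[\<phi> (x \<otimes>\<^bsub>L\<^esub> y) i = \<phi> x i + \<phi> y i] (mod 2)"
  using binary_mult[OF assms] by (simp add: cong_def)

lemma binary_range:
  assumes "x \<in> carrier L" "i \<in> {1..2 * a + b}"
  shows "\<phi> x i \<in> {0, 1}"
proof -
  have "\<phi> x i \<in> carrier (integer_mod_group 2)"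
    by (rule PiE_mem[OF binary_closed]) (rule assms)+
  then show ?thesis by (auto simp: carrier_integer_mod_group)
qed

text \<open>Surjectivity of \<phi> supplies preimages of the unit vectors; the vector is restricted
  to the index set because the product group consists of extensional functions.\<close>

lemma binary_unit:
  assumes "j \<in> {1..2 * a + b}"
  obtains x where "x \<in> carrier L" "\<And>i. i \<in> {1..2 * a + b} \<Longrightarrow> \<phi> x i = (if i = j then 1 else 0)"
proof -
  let ?g = "\<lambda>i\<in>{1..2 * a + b}. if i = j then 1 else 0 :: int"
  have "\<phi> ` carrier L = (\<Pi>\<^sub>E i\<in>{1..2 * a + b}. carrier (integer_mod_group 2))"
    using binary_bij by (rule bij_betw_imp_surj_on)
  moreover have "?g \<in> (\<Pi>\<^sub>E i\<in>{1..2 * a + b}. carrier (integer_mod_group 2))"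
    by (auto simp: carrier_integer_mod_group)
  ultimately have "?g \<in> \<phi> ` carrier L" by (simp only:)
  then obtain x where x: "?g = \<phi> x" "x \<in> carrier L" by (rule imageE)
  have "\<phi> x i = (if i = j then 1 else 0)" if "i \<in> {1..2 * a + b}" for i
    unfolding x(1)[symmetric] using that by (rule restrict_apply')
  with x(2) show ?thesis by (rule that)
qed

lemma binary_nontrivial:
  assumes L: "group L" and x: "x \<in> carrier L" "x \<noteq> \<one>\<^bsub>L\<^esub>"
  obtains i where "i \<in> {1..2 * a + b}" "\<phi> x i = 1"
proof -
  interpret group L by (rule L)
  let ?P = "product_group {1..2 * a + b} (\<lambda>_. integer_mod_group 2)"
  have P: "group ?P" by simp
  have "\<phi> \<one>\<^bsub>L\<^esub> = \<one>\<^bsub>?P\<^esub>" by (rule hom_one[OF binary_hom L P])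
  then have "\<phi> x \<noteq> \<one>\<^bsub>?P\<^esub>"
    using bij_betw_imp_inj_on[OF binary_bij] x one_closed by (metis inj_onD)
  moreover have "\<phi> x = \<one>\<^bsub>?P\<^esub>" if "\<And>i. i \<in> {1..2 * a + b} \<Longrightarrow> \<phi> x i = 0"
    unfolding one_product_group
    by (rule extensionalityI[OF IntD2[OF binary_closed[OF x(1), unfolded PiE_def]] restrict_extensional]) (simp add: that)
  ultimately have "\<exists>i\<in>{1..2 * a + b}. \<phi> x i \<noteq> 0" by blast
  then show ?thesis using binary_range[OF x(1)] that by blast
qed

lemma s_form_mult:
  assumes x: "x \<in> carrier L" and y: "y \<in> carrier L"
  shows "[s_form a b \<phi> (x \<otimes>\<^bsub>L\<^esub> y) =
    s_form a b \<phi> x + s_form a b \<phi> y + 2 * s_polar a b \<phi> x y] (mod 4)"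
proof -
  let ?q = "\<lambda>i. \<phi> x i * \<phi> y (a + i) + \<phi> y i * \<phi> x (a + i)"
  have "[(\<Sum>i = 1..a. \<phi> (x \<otimes>\<^bsub>L\<^esub> y) i * \<phi> (x \<otimes>\<^bsub>L\<^esub> y) (a + i)) =
      (\<Sum>i = 1..a. (\<phi> x i + \<phi> y i) * (\<phi> x (a + i) + \<phi> y (a + i)))] (mod 2)"
    using x y by (intro cong_sum cong_mult binary_cong) auto
  also have "(\<Sum>i = 1..a. (\<phi> x i + \<phi> y i) * (\<phi> x (a + i) + \<phi> y (a + i))) =
      (\<Sum>i = 1..a. \<phi> x i * \<phi> x (a + i)) + (\<Sum>i = 1..a. \<phi> y i * \<phi> y (a + i)) + (\<Sum>i = 1..a. ?q i)"
    by (simp only: sum.distrib[symmetric]) (intro sum.cong; simp add: algebra_simps)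
  finally have 1: "[2 * (\<Sum>i = 1..a. \<phi> (x \<otimes>\<^bsub>L\<^esub> y) i * \<phi> (x \<otimes>\<^bsub>L\<^esub> y) (a + i)) =
      2 * ((\<Sum>i = 1..a. \<phi> x i * \<phi> x (a + i)) + (\<Sum>i = 1..a. \<phi> y i * \<phi> y (a + i)) + (\<Sum>i = 1..a. ?q i))]
      (mod 4)"
    by (rule cong_double)
  \<comment> \<open>For bits \<open>s\<close> and \<open>t\<close>, the residue of
    \<open>s + t\<close> modulo 2 is \<open>s + t - 2 * s * t\<close>, and the sign of the last term
    is irrelevant modulo 4. This gives the polar term of the undoubled coordinate.\<close>
  have 2: "[\<phi> (x \<otimes>\<^bsub>L\<^esub> y) i = \<phi> x i + \<phi> y i + 2 * (\<phi> x i * \<phi> y i)] (mod 4)"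
    if "i \<in> {1..2 * a + b}" for i
    using binary_mult[OF x y that] binary_range[OF x that] binary_range[OF y that]
    by (auto simp: cong_def)
  show ?thesis
  proof (cases "b = 0")
    case True
    then show ?thesis using 1 by (simp add: s_form_def s_polar_def algebra_simps)
  next
    case False
    then show ?thesis using cong_add[OF 1 2[of "2 * a + b"]]
      by (simp add: s_form_def s_polar_def algebra_simps)
  qed
qed

lemma s_polar_mult:
  assumes x: "x \<in> carrier L" and y: "y \<in> carrier L"
  shows "[s_polar a b \<phi> (x \<otimes>\<^bsub>L\<^esub> y) z = s_polar a b \<phi> x z + s_polar a b \<phi> y z] (mod 2)"
proof -
  have "[s_polar a b \<phi> (x \<otimes>\<^bsub>L\<^esub> y) z =
      (\<Sum>i = 1..a. (\<phi> x i + \<phi> y i) * \<phi> z (a + i) + \<phi> z i * (\<phi> x (a + i) + \<phi> y (a + i)))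
      + (if b = 0 then 0 else (\<phi> x (2 * a + b) + \<phi> y (2 * a + b)) * \<phi> z (2 * a + b))] (mod 2)"
    (is "[_ = ?r] (mod _)")
    unfolding s_polar_def using x y b
    by (intro cong_add cong_sum cong_mult binary_cong cong_refl) (auto intro!: cong_mult binary_cong)
  also have "?r = s_polar a b \<phi> x z + s_polar a b \<phi> y z"
    by (simp add: s_polar_def sum.distrib distrib_left distrib_right)
  finally show ?thesis .
qed

lemma s_polar_sym: "s_polar a b \<phi> x y = s_polar a b \<phi> y x"
  by (simp add: s_polar_def mult.commute add.commute)

lemma s_polar_nondegenerate:
  assumes L: "group L" and w: "w \<in> carrier L" "w \<noteq> \<one>\<^bsub>L\<^esub>"
  obtains x where "x \<in> carrier L" "s_polar a b \<phi> x w = 1"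
proof -
  obtain j where j: "j \<in> {1..2 * a + b}" "\<phi> w j = 1" using binary_nontrivial[OF L w] .
  \<comment> \<open>The coordinate paired with \<open>j\<close>: the other member of its hyperbolic
    pair, or \<open>j\<close> itself if it is the last coordinate of an odd rank. The unit vector at
    \<open>j'\<close> then picks out \<open>\<phi> w j = 1\<close>.\<close>
  define j' where "j' = (if j \<le> a then a + j else if j \<le> 2 * a then j - a else j)"
  have "j' \<in> {1..2 * a + b}" using j by (auto simp: j'_def)
  then obtain x where x: "x \<in> carrier L"
    and \<phi>x: "\<And>i. i \<in> {1..2 * a + b} \<Longrightarrow> \<phi> x i = (if i = j' then 1 else 0)"
    using binary_unit by blast
  have "(\<Sum>i = 1..a. \<phi> x i * \<phi> w (a + i) + \<phi> w i * \<phi> x (a + i)) =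
      (\<Sum>i = 1..a. (if i = j' then \<phi> w (a + j') else 0) + (if a + i = j' then \<phi> w i else 0))"
    by (intro sum.cong) (auto simp: \<phi>x)
  also have "\<dots> = (if j \<le> 2 * a then 1 else 0)"
  proof -
    consider "j \<le> a" | "a < j" "j \<le> 2 * a" | "2 * a < j" by linarith
    then show ?thesis
      using j by cases (auto simp: j'_def sum.distrib)
  qed
  finally have "s_polar a b \<phi> x w = 1"
    using j b by (auto simp: s_polar_def \<phi>x j'_def le_Suc_eq)
  then show ?thesis using that x by blast
qed

lemma perfect_s_form:
  assumes L: "comm_group L" and w: "w \<in> carrier L" "w \<noteq> \<one>\<^bsub>L\<^esub>"
  shows "(\<Sum>x\<in>carrier L. zeta 4 powi s_form a b \<phi> (x \<otimes>\<^bsub>L\<^esub> w) * cnj (zeta 4 powi s_form a b \<phi> x)) = 0"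
proof -
  interpret comm_group L by (rule L)
  \<comment> \<open>The square of \<open>zeta 4\<close> is -1, so this bicharacter has values 1 and
    -1 and sees \<open>s_polar\<close> only modulo 2.\<close>
  interpret bicharacter L "\<lambda>x y. zeta 4 powi (2 * s_polar a b \<phi> x y)"
  proof
    fix x y z assume xyz: "x \<in> carrier L" "y \<in> carrier L" "z \<in> carrier L"
    have "zeta 4 powi (2 * s_polar a b \<phi> (x \<otimes>\<^bsub>L\<^esub> y) z) =
        zeta 4 powi (2 * (s_polar a b \<phi> x z + s_polar a b \<phi> y z))"
      by (rule zeta_powi_cong) (simp, simp only: of_nat_numeral cong_double[OF s_polar_mult[OF xyz(1,2)]])
    then show "zeta 4 powi (2 * s_polar a b \<phi> (x \<otimes>\<^bsub>L\<^esub> y) z) =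
        zeta 4 powi (2 * s_polar a b \<phi> x z) * zeta 4 powi (2 * s_polar a b \<phi> y z)"
      by (simp add: distrib_left power_int_add)
  qed (simp_all add: s_polar_sym)
  obtain x0 where x0: "x0 \<in> carrier L" "s_polar a b \<phi> x0 w = 1"
    using s_polar_nondegenerate[OF is_group w] .
  show ?thesis
  proof (rule perfect_quadratic[OF _ _ w(1) x0(1)])
    fix x y assume "x \<in> carrier L" "y \<in> carrier L"
    then have "zeta 4 powi s_form a b \<phi> (x \<otimes>\<^bsub>L\<^esub> y) =
        zeta 4 powi (s_form a b \<phi> x + s_form a b \<phi> y + 2 * s_polar a b \<phi> x y)"
      by (intro zeta_powi_cong) (simp, simp only: of_nat_numeral s_form_mult)
    then show "zeta 4 powi s_form a b \<phi> (x \<otimes>\<^bsub>L\<^esub> y) =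
        zeta 4 powi s_form a b \<phi> x * zeta 4 powi s_form a b \<phi> y * zeta 4 powi (2 * s_polar a b \<phi> x y)"
      by (simp add: power_int_add)
  qed (use x0 zeta_powi_eq_1_iff[of 4 2] in simp_all)
qed

end


section \<open>Assembling the matrix from its two factors\<close>

text \<open>A nonzero shift has a nonzero component in \<open>G\<close> or in \<open>L\<close>, so
  after factoring one vanishing factor suffices.\<close>

lemma sum_DirProd_autocorrelation:
  fixes F :: "'a \<Rightarrow> complex" and S :: "'b \<Rightarrow> complex"
  assumes "x \<in> carrier G" "y \<in> carrier L"
  shows "(\<Sum>z\<in>carrier (G \<times>\<times> L). (\<lambda>(g, l). F g * S l) (z \<otimes>\<^bsub>G \<times>\<times> L\<^esub> (x, y)) * cnj ((\<lambda>(g, l). F g * S l) z)) =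
    (\<Sum>g\<in>carrier G. F (g \<otimes>\<^bsub>G\<^esub> x) * cnj (F g)) * (\<Sum>l\<in>carrier L. S (l \<otimes>\<^bsub>L\<^esub> y) * cnj (S l))"
proof -
  have "(\<Sum>z\<in>carrier (G \<times>\<times> L). (\<lambda>(g, l). F g * S l) (z \<otimes>\<^bsub>G \<times>\<times> L\<^esub> (x, y)) * cnj ((\<lambda>(g, l). F g * S l) z)) =
      (\<Sum>(g, l)\<in>carrier G \<times> carrier L. F (g \<otimes>\<^bsub>G\<^esub> x) * cnj (F g) * (S (l \<otimes>\<^bsub>L\<^esub> y) * cnj (S l)))"
    by (rule sum.cong) (simp_all add: DirProd_def case_prod_unfold)
  then show ?thesis by (simp only: sum_product sum.cartesian_product)
qed

text \<open>The multiplicity of 2 in a square is even.\<close>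

lemma even_exponent_if_power_2_square:
  assumes "b \<in> {0, 1}" "(2::nat) ^ (2 * a + b) = n ^ 2"
  shows "b = 0"
proof -
  have "n \<noteq> 0" using assms(2) by (intro notI) simp
  then have "multiplicity 2 (n ^ 2) = 2 * multiplicity 2 n"
    by (simp add: prime_elem_multiplicity_power_distrib)
  moreover have "multiplicity 2 ((2::nat) ^ (2 * a + b)) = 2 * a + b"
    by (rule multiplicity_same_power) auto
  ultimately have "2 * a + b = 2 * multiplicity 2 n" using assms(2) by simp
  then have "even b" by presburger
  then show ?thesis using assms(1) by auto
qed

text \<open>With \<open>u = 2h = 2k\<close>, both sides equal the square of \<open>B h k\<close>.
  Hence the choice of a square root does not affect the matrix.\<close>

lemma (in bicharacter) square_root_form_unique:
  assumes "is_square_root G h u" "is_square_root G k u"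
  shows "B h u = B k u"
proof -
  have hk: "h \<in> carrier G" "k \<in> carrier G" "u = h \<otimes> h" "u = k \<otimes> k"
    using assms by (auto simp: is_square_root_def)
  have "B h (k \<otimes> k) = B h k * B h k" using hk(1,2) by (simp add: mult_right)
  also have "\<dots> = B k (h \<otimes> h)" using hk(1,2) by (simp add: mult_right sym[of k h])
  finally show ?thesis using hk by simp
qed

theorem theorem2p1:
  fixes G :: "('g, 'm) monoid_scheme" and L :: "('l, 'n) monoid_scheme"
    and K :: "('g \<times> 'l) monoid"
    and U R :: "'g set" and f :: "'g \<Rightarrow> 'g \<Rightarrow> int"
    and e a b e1 :: nat and \<beta> :: int
    and \<phi> :: "'l \<Rightarrow> nat \<Rightarrow> int"
    and half :: "'g \<times> 'l \<Rightarrow> 'g \<times> 'l \<Rightarrow> 'g"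
    and H :: "'g \<times> 'l \<Rightarrow> 'g \<times> 'l \<Rightarrow> complex"
  assumes G: "comm_group G" "finite (carrier G)"
    and L: "comm_group L" "finite (carrier L)"
    and L_cases: "carrier L = {\<one>\<^bsub>L\<^esub>} \<or> elementary_abelian_2_group L"
    and K: "K = G \<times>\<times> L"
    and e: "e = group_exponent G"
    and U: "subgroup U G"
    and U_roots: "\<forall>u \<in> U. \<exists>h. is_square_root G h u"
    and f: "bilinear_form G e f" "symmetric_form G f" "nondegenerate_form G f"
    and U_orth: "\<not> (\<exists>g \<in> carrier G - U. \<forall>u \<in> U. orthogonal_wrt f g u)"
    and R: "complete_coset_reps G U R" "\<one>\<^bsub>G\<^esub> \<in> R"
    and \<beta>: "coprime \<beta> (int (order G))"
    and ab: "b \<in> {0, 1}" "order L = 2 ^ (2 * a + b)"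
    and \<phi>: "binary_identification L (2 * a + b) \<phi>"
    and half: "\<And>y x. y \<in> carrier K \<Longrightarrow> x \<in> carrier K \<Longrightarrow>
      is_square_root G (half y x) (comp1 G L U R (x \<otimes>\<^bsub>K\<^esub> inv\<^bsub>K\<^esub> y))"
    and H: "\<And>y x. y \<in> carrier K \<Longrightarrow> x \<in> carrier K \<Longrightarrow>
      H y x =
        (let d = x \<otimes>\<^bsub>K\<^esub> inv\<^bsub>K\<^esub> y; d1 = comp1 G L U R d; d2 = comp2 G L U R d in
          zeta e powi (f (half y x) d1 + \<beta> * f d1 d2)
          * zeta 4 powi s_form a b \<phi> (comp3 G L U R x \<otimes>\<^bsub>L\<^esub> comp3 G L U R y))"
    and e1: "e1 =
      (if carrier L = {\<one>\<^bsub>L\<^esub>} then subgroup_exponent G U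
       else if \<exists>n. order L = n ^ 2 then lcm 2 (subgroup_exponent G U)
       else lcm 4 (subgroup_exponent G U))"
  shows "BH_matrix K e1 H"
proof -
  interpret comm_group G by (rule G)
  interpret L: comm_group L by (rule L)
  have e_pos: "e > 0" using group_exponent_pos[OF G(2)] e by simp
  define B where "B x y = zeta e powi f x y" for x y
  interpret bicharacter G B
    using bicharacter_of_form[OF G(1) e_pos f(1,2)] unfolding B_def .
  have B_eq_1: "B x y = 1 \<longleftrightarrow> f x y = 0" if "x \<in> carrier G" "y \<in> carrier G" for x y
    unfolding B_def using zeta_form_eq_1_iff[OF f(1) e_pos that] .
  have U_carrier: "u \<in> carrier G" if "u \<in> U" for u by (rule subgroup.mem_carrier[OF U that])
  have R_carrier: "v \<in> carrier G" if "v \<in> R" for v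
    using that R by (auto simp: complete_coset_reps_def)

  \<comment> \<open>The component functions on \<open>G\<close> alone are read off from elements
    with trivial \<open>L\<close>-part.\<close>
  have "\<exists>u v. u \<in> U \<and> v \<in> R \<and> x = u \<otimes>\<^bsub>G\<^esub> v" if "x \<in> carrier G" for x
  proof -
    have "(x, \<one>\<^bsub>L\<^esub>) \<in> carrier (G \<times>\<times> L)" using that by (simp add: DirProd_def)
    from components_ex[OF is_group U R(1) this] obtain u v l
      where "u \<in> U" "v \<in> R" "(x, \<one>\<^bsub>L\<^esub>) = (u \<otimes>\<^bsub>G\<^esub> v, l)" .
    then show ?thesis by auto
  qed
  then obtain p r where p: "\<And>x. x \<in> carrier G \<Longrightarrow> p x \<in> U"
    and r: "\<And>x. x \<in> carrier G \<Longrightarrow> r x \<in> R"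
    and pr: "\<And>x. x \<in> carrier G \<Longrightarrow> x = p x \<otimes>\<^bsub>G\<^esub> r x"
    by metis
  have comps: "components G L U R (x, l) = (p x, r x, l)" if "x \<in> carrier G" "l \<in> carrier L" for x l
    using components_eqI[OF is_group U R(1) p r that(2), OF that(1,1)] pr[OF that(1)] by simp
  have "(p (u \<otimes>\<^bsub>G\<^esub> x), r (u \<otimes>\<^bsub>G\<^esub> x), \<one>\<^bsub>L\<^esub>) = (u \<otimes>\<^bsub>G\<^esub> p x, r x, \<one>\<^bsub>L\<^esub>)"
    if ux: "u \<in> U" "x \<in> carrier G" for u x
  proof -
    have c: "u \<in> carrier G" "p x \<in> carrier G" "r x \<in> carrier G"
      using U_carrier R_carrier p r ux by blast+
    have "u \<otimes>\<^bsub>G\<^esub> x = u \<otimes>\<^bsub>G\<^esub> p x \<otimes>\<^bsub>G\<^esub> r x"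
      using pr[OF ux(2)] m_assoc[OF c] by simp
    then have "components G L U R (u \<otimes>\<^bsub>G\<^esub> x, \<one>\<^bsub>L\<^esub>) = (u \<otimes>\<^bsub>G\<^esub> p x, r x, \<one>\<^bsub>L\<^esub>)"
      using components_eqI[OF is_group U R(1) subgroup.m_closed[OF U ux(1) p[OF ux(2)]] r[OF ux(2)] L.one_closed]
      by simp
    then show ?thesis using comps[OF m_closed[OF c(1) ux(2)] L.one_closed] by simp
  qed
  then have p_U: "p (u \<otimes>\<^bsub>G\<^esub> x) = u \<otimes>\<^bsub>G\<^esub> p x" and r_U: "r (u \<otimes>\<^bsub>G\<^esub> x) = r x"
    if "u \<in> U" "x \<in> carrier G" for u x using that by simp_all

  \<comment> \<open>The root fixed here may differ from \<open>half y x\<close>, which can vary with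
    the entry; the values agree by \<open>square_root_form_unique\<close>.\<close>
  define Q where "Q u = B (SOME h. is_square_root G h u) u" for u
  have Q: "Q u = B h u" if "is_square_root G h u" for h u
    unfolding Q_def using square_root_form_unique[OF someI[of "\<lambda>h. is_square_root G h u", OF that] that] .
  have Q_mult: "Q (u \<otimes>\<^bsub>G\<^esub> v) = Q u * Q v * B u v" if "u \<in> U" "v \<in> U" for u v
    by (rule square_root_form_mult[OF U _ _ that]) (rule bspec[OF U_roots] Q, assumption)+
  have norm_Q: "norm (Q u) = 1" if "u \<in> U" for u
  proof -
    from bspec[OF U_roots that] obtain h where h: "is_square_root G h u" ..
    then have "h \<in> carrier G" unfolding is_square_root_def ..
    then show ?thesis unfolding Q[OF h] by (rule norm_B) (rule U_carrier[OF that])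
  qed
  define F where "F x = Q (p x) * B (p x) (r x) powi \<beta>" for x
  have perfect_F: "(\<Sum>x\<in>carrier G. F (x \<otimes>\<^bsub>G\<^esub> w) * cnj (F x)) = 0"
    if w: "w \<in> carrier G" "w \<noteq> \<one>\<^bsub>G\<^esub>" for w
  proof (rule perfect_coset_quadratic[where Q = Q and p = p and r = r, OF G(2) U])
    show "g \<in> U" if "g \<in> carrier G" "\<And>u. u \<in> U \<Longrightarrow> B u g = 1" for g
    proof -
      have "\<forall>u\<in>U. orthogonal_wrt f g u"
        using that B_eq_1 sym U_carrier unfolding orthogonal_wrt_def by metis
      then show ?thesis using U_orth that(1) by blast
    qed
    show "g = \<one>\<^bsub>G\<^esub>" if "g \<in> carrier G" "\<And>x. x \<in> carrier G \<Longrightarrow> B g x = 1" for g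
      using that B_eq_1 f(3) unfolding nondegenerate_form_def by blast
  qed (fact Q_mult norm_Q p p_U r_U \<beta> w pr[symmetric] R_carrier[OF r] | rule F_def)+

  define S where "S l = zeta 4 powi s_form a b \<phi> l" for l
  define P where "P = (\<lambda>(g, l). F g * S l)"
  have LL: "l \<otimes>\<^bsub>L\<^esub> l = \<one>\<^bsub>L\<^esub>" if "l \<in> carrier L" for l
    using L_cases that by (auto simp: elementary_abelian_2_group_def)
  show ?thesis
  proof (rule BH_matrix_group_developed[where P = P])
    show "group K" unfolding K by (rule DirProd_group[OF is_group L.is_group])
    show "finite (carrier K)" using G(2) L(2) by (simp add: K DirProd_def)
    show "e1 > 0" using subgroup_exponent_pos[OF U G(2)] by (simp add: e1 lcm_pos_nat)
  next
    fix y x assume yx: "y \<in> carrier K" "x \<in> carrier K"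
    obtain g l g' l' where y: "y = (g, l)" and x: "x = (g', l')" by (cases y, cases x)
    have c: "g \<in> carrier G" "l \<in> carrier L" "g' \<in> carrier G" "l' \<in> carrier L"
      using yx by (auto simp: K x y DirProd_def)
    \<comment> \<open>Every element of \<open>L\<close> is its own inverse, so the
      \<open>L\<close>-part of the difference is the sum occurring in \<open>H\<close>.\<close>
    have d: "x \<otimes>\<^bsub>K\<^esub> inv\<^bsub>K\<^esub> y = (g' \<otimes>\<^bsub>G\<^esub> inv\<^bsub>G\<^esub> g, l' \<otimes>\<^bsub>L\<^esub> l)"
      using c L.inv_equality[OF LL[OF c(2)] c(2,2)] by (simp add: K x y inv_DirProd is_group L.is_group)
    let ?d = "g' \<otimes>\<^bsub>G\<^esub> inv\<^bsub>G\<^esub> g"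
    have dc: "components G L U R (x \<otimes>\<^bsub>K\<^esub> inv\<^bsub>K\<^esub> y) = (p ?d, r ?d, l' \<otimes>\<^bsub>L\<^esub> l)"
      unfolding d using c by (intro comps) auto
    have root: "is_square_root G (half y x) (p ?d)"
      using half[OF yx] by (simp add: comp1_def dc)
    have "H y x = zeta e powi (f (half y x) (p ?d) + \<beta> * f (p ?d) (r ?d)) * S (l' \<otimes>\<^bsub>L\<^esub> l)"
      unfolding H[OF yx] Let_def comp1_def comp2_def comp3_def dc S_def
      using c by (simp add: comps x y)
    also have "zeta e powi (f (half y x) (p ?d) + \<beta> * f (p ?d) (r ?d)) = F ?d"
      by (simp add: F_def Q[OF root] B_def power_int_add mult.commute[of \<beta>] power_int_mult)
    finally show "H y x = P (x \<otimes>\<^bsub>K\<^esub> inv\<^bsub>K\<^esub> y)" by (simp add: d P_def)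
  next
    fix z assume "z \<in> carrier K"
    then obtain x l where z: "z = (x, l)" "x \<in> carrier G" "l \<in> carrier L"
      by (auto simp: K DirProd_def)
    let ?m = "subgroup_exponent G U"
    \<comment> \<open>One argument in \<open>U\<close> is enough, since the power can be moved onto
      it. Both factors of \<open>F\<close> have such an argument, by symmetry in the case of
      \<open>B (p x) (r x)\<close>.\<close>
    have root_m: "B h u ^ ?m = 1" if "h \<in> carrier G" "u \<in> U" for h u
      using nat_pow_right[OF that(1) U_carrier[OF that(2)], of ?m] that
      by (simp add: pow_subgroup_exponent[OF U])
    have "F x ^ ?m = 1"
    proof -
      from bspec[OF U_roots p[OF z(2)]] obtain h where h: "is_square_root G h (p x)" ..
      then have "h \<in> carrier G" unfolding is_square_root_def ..
      then have "Q (p x) ^ ?m = 1" unfolding Q[OF h] by (rule root_m) (rule p[OF z(2)])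
      moreover have "(B (p x) (r x) powi \<beta>) ^ ?m = (B (r x) (p x) ^ ?m) powi \<beta>"
        using sym[OF U_carrier[OF p] R_carrier[OF r], OF z(2,2)]
        by (simp add: mult.commute flip: power_int_of_nat power_int_mult)
      ultimately show ?thesis
        unfolding F_def power_mult_distrib root_m[OF R_carrier[OF r] p, OF z(2,2)] by simp
    qed
    \<comment> \<open>The exponents 1, 2 and 4 match the three cases of \<open>e1\<close>: for
      trivial \<open>L\<close> the form is zero, for square order \<open>b = 0\<close> makes
      \<open>s_form\<close> even, and otherwise only fourth roots of unity are guaranteed.\<close>
    moreover have "\<exists>k. S l ^ k = 1 \<and> k dvd e1 \<and> ?m dvd e1"
    proof (cases "carrier L = {\<one>\<^bsub>L\<^esub>}")
      case True
      then have "2 ^ (2 * a + b) = (1::nat)" using ab(2)[symmetric] by (simp add: order_def)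
      then have "2 * a + b = 0" by simp
      then show ?thesis using True by (intro exI[of _ 1]) (simp add: S_def s_form_def e1)
    next
      case False
      show ?thesis
      proof (cases "\<exists>n. order L = n ^ 2")
        case True
        then have "b = 0" using even_exponent_if_power_2_square ab by metis
        then have "S l ^ 2 = 1" unfolding S_def
          by (intro zeta_powi_power_eq_1) (simp_all add: s_form_def)
        then show ?thesis using True False by (intro exI[of _ 2]) (simp add: e1)
      next
        case nonsquare: False
        have "S l ^ 4 = 1" unfolding S_def by (intro zeta_powi_power_eq_1) simp_all
        then show ?thesis using nonsquare False by (intro exI[of _ 4]) (simp add: e1)
      qed
    qed
    moreover have "t ^ n = 1" if "t ^ k = 1" "k dvd n" for t :: complex and k n
      using that by (auto elim!: dvdE simp: power_mult)
    ultimately have "F x ^ e1 = 1" "S l ^ e1 = 1" by blast+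
    then show "P z ^ e1 = 1" by (simp add: P_def z(1) power_mult_distrib)
  next
    fix w assume w: "w \<in> carrier K" "w \<noteq> \<one>\<^bsub>K\<^esub>"
    obtain x l where xl: "w = (x, l)" "x \<in> carrier G" "l \<in> carrier L"
      using w(1) by (auto simp: K DirProd_def)
    then have "x \<noteq> \<one>\<^bsub>G\<^esub> \<or> l \<noteq> \<one>\<^bsub>L\<^esub>" using w(2) by (auto simp: K)
    then have "(\<Sum>g\<in>carrier G. F (g \<otimes>\<^bsub>G\<^esub> x) * cnj (F g)) = 0 \<or>
        (\<Sum>l'\<in>carrier L. S (l' \<otimes>\<^bsub>L\<^esub> l) * cnj (S l')) = 0"
      unfolding S_def using perfect_F perfect_s_form[OF \<phi> ab(1) L(1)] xl(2,3) by blast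
    then show "(\<Sum>z\<in>carrier K. P (z \<otimes>\<^bsub>K\<^esub> w) * cnj (P z)) = 0"
      unfolding K xl(1) P_def sum_DirProd_autocorrelation[OF xl(2,3)] by simp
  qed
qed

end
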